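(* Let $A\in \mathbb{R}^{n\times n}$ be a symmetric matrix, let $\vec b \in\mathbb{R}^n$, and let $Q_{k+1}\in\mathbb{R}^{n\times (k+1)}$ be the matrix with orthonormal columns generated by the rational Arnoldi algorithm for $A$ and $\vec b$ using poles $\{\xi_1,\dots,\xi_k\}$ different from zero and infinity. Assuming that $k+1$ is less than the invariance index, we have $$J_{k+1}:=Q_{k+1}^TAQ_{k+1}=S+\tilde D_{k},$$ where $\tilde D_{k}=\mathrm{diag}(0,\xi_1,\dots,\xi_{k})$ and $S$ is a symmetric generator representable semiseparable matrix.
   Context: Rational Krylov subspaces: given real poles $\xi_1,\xi_2,\dots$ that are not eigenvalues of $A$, let $q_{j-1}(z)=\prod_{i=1}^{j-1}(1-z/\xi_i)$ (with $1/\infty=0$) and $\mathcal{Q}_j(A,\vec b)=q_{j-1}(A)^{-1}\mathrm{span}\{\vec b,A\vec b,\dots,A^{j-1}\vec b\}$. The invariance index is the smallest integer $K$ such that $\mathcal{Q}_K(A,\vec b)=\mathcal{Q}_{K+1}(A,\vec b)$; equivalently, the smallest $K$ with $\mathrm{span}\{\vec b,\dots,A^{K-1}\vec b\}=\mathrm{span}\{\vec b,\dots,A^{K}\vec b\}$ (it does not depend on the poles). Rational Arnoldi algorithm: the first column of $Q_{k+1}=[\vec v_1,\dots,\vec v_{k+1}]$ is $\vec v_1=\vec b/\|\vec b\|_2$, and for $j=1,\dots,k$ the vector $\vec v_{j+1}$ is obtained by orthonormalizing $(I-\frac{1}{\xi_j}A)^{-1}A\vec v_j$ against $\vec v_1,\dots,\vec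 v_j$; it is assumed that the algorithm does not break down, i.e. $(I-\frac{1}{\xi_j}A)^{-1}A\vec v_j\in\mathcal{Q}_{j+1}(A,\vec b)\setminus\mathcal{Q}_j(A,\vec b)$ for each $j$. Thus $\vec v_1,\dots,\vec v_j$ is an orthonormal basis of $\mathcal{Q}_j(A,\vec b)$ for each $j\le k+1$. A matrix $S\in\mathbb{R}^{N\times N}$ is semiseparable if $\mathrm{rank}\, S(i:N,1:i)\le 1$ and $\mathrm{rank}\, S(1:i,i:N)\le 1$ for all $i=1,\dots,N$. It is generator representable semiseparable if moreover there are $\vec u,\vec v,\vec p,\vec q\in\mathbb{R}^N$ with $\mathrm{tril}(S)=\mathrm{tril}(\vec u\vec v^T)$ and $\mathrm{triu}(S)=\mathrm{triu}(\vec p\vec q^T)$, where $\mathrm{tril}$ and $\mathrm{triu}$ denote the lower and upper triangular parts including the diagonal. *)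

theory Defs
  imports
    "HOL-Library.Extended_Real"
    "Jordan_Normal_Form.Char_Poly"
    "Jordan_Normal_Form.Gauss_Jordan_Elimination"
    "Jordan_Normal_Form.DL_Rank"
    "Jordan_Normal_Form.DL_Submatrix"
begin

text \<open>Vectors and matrices are the carrier-based ones of \<^theory>\<open>Jordan_Normal_Form.Matrix\<close>; their
  entries are counted from 0, whereas the poles \<open>\<xi> 1, \<xi> 2, \<dots>\<close> are counted from 1.\<close>

abbreviation vec_span :: "nat \<Rightarrow> real vec set \<Rightarrow> real vec set" where
  "vec_span n \<equiv> LinearCombinations.module.span class_ring (module_vec TYPE(real) n)"

abbreviation mat_rank :: "real mat \<Rightarrow> nat" where
  "mat_rank M \<equiv> vec_space.rank (dim_row M) M"

definition norm2 :: "real vec \<Rightarrow> real" where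
  "norm2 x = sqrt (x \<bullet> x)"

text \<open>Only meaningful for invertible matrices.\<close>

definition minv :: "real mat \<Rightarrow> real mat" where
  "minv M = the (mat_inverse M)"


section \<open>Rational Krylov subspaces\<close>

text \<open>Poles are extended reals. Since \<open>1 / \<infinity> = 0\<close> holds there, an infinite pole (of either sign)
  contributes the factor \<open>1\<close>.\<close>

definition pole_factor :: "real mat \<Rightarrow> ereal \<Rightarrow> real mat" where
  "pole_factor A x = 1\<^sub>m (dim_row A) - real_of_ereal (1 / x) \<cdot>\<^sub>m A"

text \<open>\<open>q_mat A \<xi> m\<close> is $q_m(A)$ for $q_m(z) = \prod_{i=1}^{m} (1 - z/\xi_i)$.\<close>

primrec q_mat :: "real mat \<Rightarrow> (nat \<Rightarrow> ereal) \<Rightarrow> nat \<Rightarrow> real mat" where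
  "q_mat A \<xi> 0 = 1\<^sub>m (dim_row A)"
| "q_mat A \<xi> (Suc m) = q_mat A \<xi> m * pole_factor A (\<xi> (Suc m))"

text \<open>The value \<open>0\<close> is excluded because \<open>1/\<xi>\<^sub>i\<close> has to make sense.\<close>

definition admissible_poles :: "real mat \<Rightarrow> (nat \<Rightarrow> ereal) \<Rightarrow> bool" where
  "admissible_poles A \<xi> \<longleftrightarrow>
     (\<forall>i\<ge>1. \<xi> i \<noteq> 0 \<and> \<not> (\<exists>x. eigenvalue A x \<and> \<xi> i = ereal x))"

definition krylov :: "real mat \<Rightarrow> real vec \<Rightarrow> nat \<Rightarrow> real vec set" where
  "krylov A b j = vec_span (dim_row A) {(A ^\<^sub>m i) *\<^sub>v b | i. i < j}"

text \<open>\<open>rational_krylov A b \<xi> j\<close> is $\mathcal{Q}_j(A,b)$, for $j \ge 1$.\<close>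

definition rational_krylov :: "real mat \<Rightarrow> real vec \<Rightarrow> (nat \<Rightarrow> ereal) \<Rightarrow> nat \<Rightarrow> real vec set" where
  "rational_krylov A b \<xi> j = (\<lambda>x. minv (q_mat A \<xi> (j - 1)) *\<^sub>v x) ` krylov A b j"

definition invariance_index :: "real mat \<Rightarrow> real vec \<Rightarrow> (nat \<Rightarrow> ereal) \<Rightarrow> nat" where
  "invariance_index A b \<xi> =
     (LEAST K. 1 \<le> K \<and> rational_krylov A b \<xi> K = rational_krylov A b \<xi> (K + 1))"


section \<open>The rational Arnoldi algorithm\<close>

definition orthonormalize :: "real vec list \<Rightarrow> real vec \<Rightarrow> real vec" where
  "orthonormalize vs w =
     (let r = foldl (\<lambda>x v. x - (v \<bullet> w) \<cdot>\<^sub>v v) w vs in (1 / norm2 r) \<cdot>\<^sub>v r)"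

definition arnoldi_continuation :: "real mat \<Rightarrow> ereal \<Rightarrow> real vec \<Rightarrow> real vec" where
  "arnoldi_continuation A x v = minv (pole_factor A x) *\<^sub>v (A *\<^sub>v v)"

text \<open>\<open>arnoldi_vecs A b \<xi> j\<close> is the list $[v_1, \dots, v_{j+1}]$ of the vectors after \<open>j\<close> steps.\<close>

primrec arnoldi_vecs :: "real mat \<Rightarrow> real vec \<Rightarrow> (nat \<Rightarrow> ereal) \<Rightarrow> nat \<Rightarrow> real vec list" where
  "arnoldi_vecs A b \<xi> 0 = [(1 / norm2 b) \<cdot>\<^sub>v b]"
| "arnoldi_vecs A b \<xi> (Suc j) =
     (let vs = arnoldi_vecs A b \<xi> j
      in vs @ [orthonormalize vs (arnoldi_continuation A (\<xi> (Suc j)) (last vs))])"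

text \<open>\<open>arnoldi_mat A b \<xi> k\<close> is $Q_{k+1}$.\<close>

definition arnoldi_mat :: "real mat \<Rightarrow> real vec \<Rightarrow> (nat \<Rightarrow> ereal) \<Rightarrow> nat \<Rightarrow> real mat" where
  "arnoldi_mat A b \<xi> k = mat_of_cols (dim_row A) (arnoldi_vecs A b \<xi> k)"

text \<open>In step \<open>j\<close> the vector $v_j$ that is continued is the last one of \<open>arnoldi_vecs A b \<xi> (j - 1)\<close>.\<close>

definition arnoldi_no_breakdown ::
    "real mat \<Rightarrow> real vec \<Rightarrow> (nat \<Rightarrow> ereal) \<Rightarrow> nat \<Rightarrow> bool" where
  "arnoldi_no_breakdown A b \<xi> k \<longleftrightarrow>
     (\<forall>j\<in>{1..k}. arnoldi_continuation A (\<xi> j) (last (arnoldi_vecs A b \<xi> (j - 1)))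
                    \<in> rational_krylov A b \<xi> (j + 1) - rational_krylov A b \<xi> j)"


section \<open>Semiseparable matrices\<close>

definition tril :: "real mat \<Rightarrow> real mat" where
  "tril M = mat (dim_row M) (dim_col M) (\<lambda>(i, j). if j \<le> i then M $$ (i, j) else 0)"

definition triu :: "real mat \<Rightarrow> real mat" where
  "triu M = mat (dim_row M) (dim_col M) (\<lambda>(i, j). if i \<le> j then M $$ (i, j) else 0)"

definition outer_prod :: "real vec \<Rightarrow> real vec \<Rightarrow> real mat" where
  "outer_prod u v = mat (dim_vec u) (dim_vec v) (\<lambda>(i, j). u $ i * v $ j)"

definition semiseparable :: "nat \<Rightarrow> real mat \<Rightarrow> bool" where
  "semiseparable N S \<longleftrightarrow> S \<in> carrier_mat N N \<and>
     (\<forall>i<N. mat_rank (submatrix S {i..<N} {0..i}) \<le> 1 \<and>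
            mat_rank (submatrix S {0..i} {i..<N}) \<le> 1)"

definition generator_representable_semiseparable :: "nat \<Rightarrow> real mat \<Rightarrow> bool" where
  "generator_representable_semiseparable N S \<longleftrightarrow> semiseparable N S \<and>
     (\<exists>u\<in>carrier_vec N. \<exists>v\<in>carrier_vec N. \<exists>p\<in>carrier_vec N. \<exists>q\<in>carrier_vec N.
        tril S = tril (outer_prod u v) \<and> triu S = triu (outer_prod p q))"

end

theory Submission
  imports Defs
begin

text \<open>Put $h_0 = b$ and $h_j = (I - A/\xi_j)^{-1} A h_{j-1}$. Then $\mathcal{Q}_{j+1}(A,b)$ is spanned by
  $h_0, \dots, h_j$, and the definition of $h_j$ rearranges to $A h_j = \xi_j (h_j - A h_{j-1})$.
  Count the Arnoldi vectors from 0, so that $v_i$ is orthogonal to $h_l$ for $l < i$. Taking the inner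
  product of the recurrence with $v_i$ gives $v_i \cdot A h_l = (v_i \cdot A b) \prod_{m \le l} (-\xi_m)$ for
  $l < i$, with the extra summand $\xi_i (v_i \cdot h_i)$ for $l = i$. Expanding $v_j$ in
  $h_0, \dots, h_j$ therefore yields $v_i \cdot A v_j = u_i w_j$ for $j < i$ and
  $v_i \cdot A v_i = u_i w_i + \xi_i$, where $u_i = v_i \cdot A b$.\<close>

section \<open>Spans of vectors\<close>

context
  fixes n :: nat and S :: "real vec set"
  assumes S: "S \<subseteq> carrier_vec n"
begin

interpretation vec_space "TYPE(real)" n .

lemma vec_span_closed: "x \<in> vec_span n S \<Longrightarrow> x \<in> carrier_vec n"
  using span_closed[of S x] S by simp

lemma vec_span_base: "x \<in> S \<Longrightarrow> x \<in> vec_span n S"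
  using in_own_span[of S] S by auto

lemma vec_span_zero: "0\<^sub>v n \<in> vec_span n S"
  using vectorspace.span_zero[OF vec_vs, of n S] by simp

lemma vec_span_add: "x \<in> vec_span n S \<Longrightarrow> y \<in> vec_span n S \<Longrightarrow> x + y \<in> vec_span n S"
  using span_add1[of S x y] S by simp

lemma vec_span_smult: "x \<in> vec_span n S \<Longrightarrow> c \<cdot>\<^sub>v x \<in> vec_span n S"
  using smult_in_span[of S x c] S by simp

lemma vec_span_diff: "x \<in> vec_span n S \<Longrightarrow> y \<in> vec_span n S \<Longrightarrow> x - y \<in> vec_span n S"
proof -
  assume x: "x \<in> vec_span n S" and y: "y \<in> vec_span n S"
  have "x - y = x + (- 1) \<cdot>\<^sub>v y"
    using vec_span_closed[OF x] vec_span_closed[OF y] by auto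
  then show ?thesis using x y by (simp add: vec_span_add vec_span_smult)
qed

end

text \<open>The span elements satisfying \<open>P\<close> form a submodule containing
  \<open>S\<close>, hence all of the span. The \<open>add\<close> and \<open>smult\<close> cases
  retain membership in the span so that dimensions stay known.\<close>

lemma vec_span_induct [consumes 2, case_names base zero add smult]:
  fixes S :: "real vec set"
  assumes S: "S \<subseteq> carrier_vec n"
    and x: "x \<in> vec_span n S"
    and base: "\<And>x. x \<in> S \<Longrightarrow> P x"
    and zero: "P (0\<^sub>v n)"
    and add: "\<And>x y. x \<in> vec_span n S \<Longrightarrow> y \<in> vec_span n S \<Longrightarrow> P x \<Longrightarrow> P y \<Longrightarrow> P (x + y)"
    and smult: "\<And>x c. x \<in> vec_span n S \<Longrightarrow> P x \<Longrightarrow> P (c \<cdot>\<^sub>v x)"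
  shows "P x"
proof -
  interpret vec_space "TYPE(real)" n .
  let ?N = "{x \<in> vec_span n S. P x}"
  have "submodule class_ring ?N V"
    by (rule submodule.intro)
      (auto simp: vec_span_closed[OF S] vec_span_zero[OF S] vec_span_add[OF S] vec_span_smult[OF S]
        base zero add smult module_axioms)
  then have "vec_span n S \<subseteq> ?N"
    by (intro span_is_subset) (auto simp: vec_span_base[OF S] base)
  with x show ?thesis by auto
qed

lemma vec_span_subset:
  assumes "S \<subseteq> carrier_vec n" "T \<subseteq> carrier_vec n" "\<And>x. x \<in> S \<Longrightarrow> x \<in> vec_span n T"
  shows "vec_span n S \<subseteq> vec_span n T"
proof
  fix x assume "x \<in> vec_span n S"
  with assms(1) show "x \<in> vec_span n T"
    by (induction rule: vec_span_induct)
      (auto simp: assms vec_span_zero vec_span_add vec_span_smult)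
qed

lemma vec_span_mono:
  assumes "T \<subseteq> carrier_vec n" "S \<subseteq> T"
  shows "vec_span n S \<subseteq> vec_span n T"
  using assms by (intro vec_span_subset) (auto intro: vec_span_base)

text \<open>\<open>arnoldi_basis\<close> uses this to read off how much of the newest iterate a
  continuation vector contains.\<close>

lemma vec_span_insertE:
  assumes S: "insert a S \<subseteq> carrier_vec n" and x: "x \<in> vec_span n (insert a S)"
  obtains c y where "y \<in> vec_span n S" "x = y + c \<cdot>\<^sub>v a"
proof -
  have S': "S \<subseteq> carrier_vec n" and a: "a \<in> carrier_vec n" using S by auto
  note cl = vec_span_closed[OF S']
  have "\<exists>y c. y \<in> vec_span n S \<and> x = y + c \<cdot>\<^sub>v a"
    using S x
  proof (induction rule: vec_span_induct)
    case (base x)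
    show ?case
    proof (cases "x = a")
      case True
      then show ?thesis using a vec_span_zero[OF S']
        by (intro exI[of _ "0\<^sub>v n"] exI[of _ 1]) auto
    next
      case False
      with base have "x \<in> S" by auto
      then have "x = x + 0 \<cdot>\<^sub>v a" using a S' by (intro eq_vecI) auto
      then show ?thesis using vec_span_base[OF S' \<open>x \<in> S\<close>] by blast
    qed
  next
    case zero
    show ?case using a vec_span_zero[OF S'] by (intro exI[of _ "0\<^sub>v n"] exI[of _ 0]) auto
  next
    case (add x x')
    then obtain y c y' c' where *: "y \<in> vec_span n S" "x = y + c \<cdot>\<^sub>v a"
      "y' \<in> vec_span n S" "x' = y' + c' \<cdot>\<^sub>v a" by blast
    then have "x + x' = (y + y') + (c + c') \<cdot>\<^sub>v a"
      using cl[OF *(1)] cl[OF *(3)] a by (auto simp: algebra_simps)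
    then show ?case using vec_span_add[OF S' *(1) *(3)] by blast
  next
    case (smult x d)
    then obtain y c where *: "y \<in> vec_span n S" "x = y + c \<cdot>\<^sub>v a" by blast
    then have "d \<cdot>\<^sub>v x = d \<cdot>\<^sub>v y + (d * c) \<cdot>\<^sub>v a"
      using cl[OF *(1)] a by (auto simp: algebra_simps)
    then show ?case using vec_span_smult[OF S' *(1)] by blast
  qed
  then show thesis using that by blast
qed

lemma smult_mult_mat_vec:
  assumes "(B :: real mat) \<in> carrier_mat r n" "y \<in> carrier_vec n"
  shows "(c \<cdot>\<^sub>m B) *\<^sub>v y = c \<cdot>\<^sub>v (B *\<^sub>v y)"
  using assms by (intro eq_vecI) auto

lemma mult_mat_zero_vec:
  assumes "(B :: real mat) \<in> carrier_mat r n"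
  shows "B *\<^sub>v 0\<^sub>v n = 0\<^sub>v r"
  using assms by (intro eq_vecI) auto

lemma add_smult_diff:
  assumes "(y :: real vec) \<in> carrier_vec n" "z \<in> carrier_vec n"
  shows "y + c \<cdot>\<^sub>v z - c \<cdot>\<^sub>v z = y"
  using assms by (intro eq_vecI) auto

section \<open>Gram-Schmidt\<close>

lemma scalar_prod_self_pos:
  fixes x :: "real vec"
  assumes "x \<in> carrier_vec n" "x \<noteq> 0\<^sub>v n"
  shows "0 < x \<bullet> x"
proof (rule ccontr)
  assume "\<not> 0 < x \<bullet> x"
  moreover have "x \<bullet> x = (\<Sum>i<n. x $ i * x $ i)"
    using assms(1) by (auto simp: scalar_prod_def atLeast0LessThan)
  ultimately have "(\<Sum>i<n. x $ i * x $ i) = 0"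
    using sum_nonneg[of "{..<n}" "\<lambda>i. x $ i * x $ i"] by auto
  then have "\<forall>i<n. x $ i = 0"
    by (subst (asm) sum_nonneg_eq_0_iff) auto
  then have "x = 0\<^sub>v n" using assms(1) by (intro eq_vecI) auto
  with assms(2) show False by blast
qed

lemma norm2_normalized:
  assumes "x \<in> carrier_vec n" "x \<noteq> 0\<^sub>v n"
  shows "0 < norm2 x" "((1 / norm2 x) \<cdot>\<^sub>v x) \<bullet> ((1 / norm2 x) \<cdot>\<^sub>v x) = 1"
  using scalar_prod_self_pos[OF assms] assms(1) by (auto simp: norm2_def field_simps)

text \<open>The first \<open>m\<close> subtractions of the fold in \<open>orthonormalize\<close>,
  exposed for induction. The coefficients are taken against \<open>w\<close> itself and not against
  the running remainder, as in classical Gram-Schmidt.\<close>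

definition residual :: "(nat \<Rightarrow> real vec) \<Rightarrow> real vec \<Rightarrow> nat \<Rightarrow> real vec" where
  "residual v w m = foldl (\<lambda>x u. x - (u \<bullet> w) \<cdot>\<^sub>v u) w (map v [0..<m])"

lemma residual_0: "residual v w 0 = w"
  by (simp add: residual_def)

lemma residual_Suc: "residual v w (Suc m) = residual v w m - (v m \<bullet> w) \<cdot>\<^sub>v v m"
  by (simp add: residual_def)

context
  fixes v :: "nat \<Rightarrow> real vec" and w :: "real vec" and n N :: nat
  assumes v: "\<And>i. i < N \<Longrightarrow> v i \<in> carrier_vec n"
    and w: "w \<in> carrier_vec n"
begin

lemma residual_carrier: "m \<le> N \<Longrightarrow> residual v w m \<in> carrier_vec n"
  using v w by (induction m) (auto simp: residual_0 residual_Suc)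

lemma residual_diff:
  "m \<le> N \<Longrightarrow> w - residual v w m \<in> vec_span n (v ` {..<N})"
proof (induction m)
  case 0
  have "v ` {..<N} \<subseteq> carrier_vec n" using v by auto
  then show ?case using w by (simp add: residual_0 vec_span_zero)
next
  case (Suc m)
  have V: "v ` {..<N} \<subseteq> carrier_vec n" using v by auto
  have "w - residual v w (Suc m) = (w - residual v w m) + (v m \<bullet> w) \<cdot>\<^sub>v v m"
    using w residual_carrier[of m] v[of m] Suc.prems by (auto simp: residual_Suc)
  moreover have "v m \<in> vec_span n (v ` {..<N})"
    using Suc.prems by (intro vec_span_base[OF V]) auto
  ultimately show ?case using Suc by (simp add: vec_span_add[OF V] vec_span_smult[OF V])
qed

text \<open>Step \<open>m\<close> kills the component along \<open>v m\<close> and, by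
  orthonormality, leaves the others alone. Components not yet treated are tracked as well, since
  they must still equal the coefficient subtracted later.\<close>

lemma residual_orthogonal:
  assumes "\<And>i j. i < N \<Longrightarrow> j < N \<Longrightarrow> v i \<bullet> v j = (if i = j then 1 else 0)"
  shows "m \<le> N \<Longrightarrow> l < N \<Longrightarrow> v l \<bullet> residual v w m = (if l < m then 0 else v l \<bullet> w)"
proof (induction m)
  case (Suc m)
  then show ?case
    using v[of l] v[of m] residual_carrier[of m] assms[of l m]
    by (auto simp: residual_Suc scalar_prod_minus_distrib[of _ n] less_Suc_eq split: if_splits)
qed (simp add: residual_0)

end

section \<open>Rational Krylov spaces\<close>

text \<open>The vectors h_j of the overview: continuation without orthogonalization. They differ
  from the Arnoldi vectors, but \<open>arnoldi_basis\<close> shows that the leading spans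
  agree.\<close>

primrec rational_iterate :: "real mat \<Rightarrow> real vec \<Rightarrow> (nat \<Rightarrow> ereal) \<Rightarrow> nat \<Rightarrow> real vec" where
  "rational_iterate A b \<xi> 0 = b"
| "rational_iterate A b \<xi> (Suc j) = arnoldi_continuation A (\<xi> (Suc j)) (rational_iterate A b \<xi> j)"

declare rational_iterate.simps(2) [simp del]

section \<open>Invertibility of the pole factors\<close>

lemma minv_mult:
  fixes B :: "real mat"
  assumes B: "B \<in> carrier_mat n n" and inj: "\<And>y. y \<in> carrier_vec n \<Longrightarrow> B *\<^sub>v y = 0\<^sub>v n \<Longrightarrow> y = 0\<^sub>v n"
  shows "minv B \<in> carrier_mat n n" "B * minv B = 1\<^sub>m n" "minv B * B = 1\<^sub>m n"
proof -
  \<comment> \<open>\<open>minv\<close> is meaningful only if \<open>mat_inverse\<close> returns a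
    value, which a nonzero determinant ensures.\<close>
  have "det B \<noteq> 0"
  proof
    assume "det B = 0"
    then obtain y where "y \<in> carrier_vec n" "y \<noteq> 0\<^sub>v n" "B *\<^sub>v y = 0\<^sub>v n"
      unfolding det_0_iff_vec_prod_zero[OF B] by (elim exE conjE)
    with inj[of y] show False by (elim notE)
  qed
  from det_non_zero_imp_unit[OF B this, of "()"]
  have "mat_inverse B \<noteq> None" using mat_inverse(1)[OF B, of "()"] by metis
  then obtain C where "mat_inverse B = Some C" by (elim not_None_eq[THEN iffD1, THEN exE])
  with mat_inverse(2)[OF B this]
  show "minv B \<in> carrier_mat n n" "B * minv B = 1\<^sub>m n" "minv B * B = 1\<^sub>m n"
    by (auto simp: minv_def)
qed

lemma pole_factor_mult:
  assumes "A \<in> carrier_mat n n" "y \<in> carrier_vec n"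
  shows "pole_factor A z *\<^sub>v y = y - real_of_ereal (1 / z) \<cdot>\<^sub>v (A *\<^sub>v y)"
  using assms
  by (simp add: pole_factor_def minus_mult_distrib_mat_vec[of _ n n] smult_mult_mat_vec[of _ n n])

text \<open>A nonzero kernel vector of I - c A satisfies y = c A y, which forces c to be nonzero and
  makes 1/c an eigenvalue that equals the pole.\<close>

lemma pole_factor_kernel:
  assumes A: "A \<in> carrier_mat n n" and adm: "admissible_poles A \<xi>" and j: "1 \<le> j"
    and y: "y \<in> carrier_vec n" and M0: "pole_factor A (\<xi> j) *\<^sub>v y = 0\<^sub>v n"
  shows "y = 0\<^sub>v n"
proof (rule ccontr)
  assume y0: "y \<noteq> 0\<^sub>v n"
  define c where "c = real_of_ereal (1 / \<xi> j)"
  have Ay: "A *\<^sub>v y \<in> carrier_vec n" using mult_mat_vec_carrier[OF A y] .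
  have *: "y $ i = c * (A *\<^sub>v y) $ i" if "i < n" for i
  proof -
    have "(y - c \<cdot>\<^sub>v (A *\<^sub>v y)) $ i = 0"
      using M0 that by (simp add: pole_factor_mult[OF A y] c_def)
    then show ?thesis
      using that y Ay by (auto simp del: index_mult_mat_vec dim_mult_mat_vec)
  qed
  have "c \<noteq> 0"
  proof
    assume "c = 0"
    then have "y = 0\<^sub>v n" using * y by (intro eq_vecI) auto
    with y0 show False ..
  qed
  have "A *\<^sub>v y = (1 / c) \<cdot>\<^sub>v y"
  proof (rule eq_vecI)
    fix i assume "i < dim_vec ((1 / c) \<cdot>\<^sub>v y)"
    then have i: "i < n" using y by auto
    then have "((1 / c) \<cdot>\<^sub>v y) $ i = (1 / c) * y $ i" using y by auto
    then show "(A *\<^sub>v y) $ i = ((1 / c) \<cdot>\<^sub>v y) $ i"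
      using *[OF i] \<open>c \<noteq> 0\<close> by (simp del: index_mult_mat_vec)
  qed (use y A in auto)
  then have "eigenvalue A (1 / c)"
    using A y y0 unfolding eigenvalue_def eigenvector_def by auto
  \<comment> \<open>An infinite pole has reciprocal 0, and a zero pole has an infinite reciprocal
    that \<open>real_of_ereal\<close> sends to 0; a nonzero \<open>c\<close> excludes both.\<close>
  moreover have "\<xi> j = ereal (1 / c)"
    using \<open>c \<noteq> 0\<close> by (cases "\<xi> j") (auto simp: c_def one_ereal_def split: if_splits)
  ultimately show False
    using adm j unfolding admissible_poles_def by blast
qed

text \<open>Finiteness is required of the first \<open>k\<close> poles only, so formulas with
  \<open>x\<close> carry a bound by \<open>k\<close>; injectivity of \<open>M (Suc j)\<close> comes
  from admissibility and holds for every \<open>j\<close>.\<close>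

locale finite_poles =
  fixes A :: "real mat" and b :: "real vec" and \<xi> :: "nat \<Rightarrow> ereal" and n k :: nat
  assumes A: "A \<in> carrier_mat n n"
    and b: "b \<in> carrier_vec n"
    and adm: "admissible_poles A \<xi>"
    and fin: "\<forall>j\<in>{1..k}. \<xi> j \<noteq> 0 \<and> \<xi> j \<noteq> \<infinity> \<and> \<xi> j \<noteq> -\<infinity>"
begin

abbreviation "h \<equiv> rational_iterate A b \<xi>"
abbreviation "x j \<equiv> real_of_ereal (\<xi> j)"
abbreviation "M j \<equiv> pole_factor A (\<xi> j)"
abbreviation "q \<equiv> q_mat A \<xi>"
abbreviation "K j \<equiv> vec_span n ((\<lambda>i. (A ^\<^sub>m i) *\<^sub>v b) ` {..<j})"

lemma pole:
  assumes "j < k"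
  shows "x (Suc j) \<noteq> 0" "\<xi> (Suc j) = ereal (x (Suc j))"
  using fin[rule_format, of "Suc j"] assms by (cases "\<xi> (Suc j)"; simp add: zero_ereal_def)+

lemma M_carrier [simp]: "M j \<in> carrier_mat n n"
  using A by (auto simp: pole_factor_def minus_carrier_mat)

lemma M_mult:
  assumes "j < k" "y \<in> carrier_vec n"
  shows "M (Suc j) *\<^sub>v y = y - (1 / x (Suc j)) \<cdot>\<^sub>v (A *\<^sub>v y)"
  using pole(2)[OF assms(1)] pole(1)[OF assms(1)]
  by (metis pole_factor_mult[OF A assms(2)] ereal_divide one_ereal_def real_of_ereal.simps(1))

lemma M_kernel:
  "y \<in> carrier_vec n \<Longrightarrow> M (Suc j) *\<^sub>v y = 0\<^sub>v n \<Longrightarrow> y = 0\<^sub>v n"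
  by (rule pole_factor_kernel[OF A adm, of "Suc j"]) auto

lemma A_mult [simp]: "y \<in> carrier_vec n \<Longrightarrow> A *\<^sub>v y \<in> carrier_vec n"
  using A by (rule mult_mat_vec_carrier)

lemma iterate:
  assumes "j \<le> k"
  shows "h j \<in> carrier_vec n"
    and "j = Suc i \<Longrightarrow> M j *\<^sub>v h j = A *\<^sub>v h i"
proof -
  have *: "arnoldi_continuation A (\<xi> (Suc i)) y \<in> carrier_vec n"
    "M (Suc i) *\<^sub>v arnoldi_continuation A (\<xi> (Suc i)) y = A *\<^sub>v y"
    if i: "i < k" and y: "y \<in> carrier_vec n" for i y
  proof -
    note C = minv_mult[OF M_carrier[of "Suc i"] M_kernel[where j = i]]
    show "arnoldi_continuation A (\<xi> (Suc i)) y \<in> carrier_vec n"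
      unfolding arnoldi_continuation_def using mult_mat_vec_carrier[OF C(1) A_mult[OF y]] .
    show "M (Suc i) *\<^sub>v arnoldi_continuation A (\<xi> (Suc i)) y = A *\<^sub>v y"
      unfolding arnoldi_continuation_def
      using assoc_mult_mat_vec[OF M_carrier C(1) A_mult[OF y], of "Suc i"] C(2) y by simp
  qed
  have hc: "h j \<in> carrier_vec n" if "j \<le> k" for j
    using that by (induction j) (auto simp: b *(1) rational_iterate.simps)
  then show "h j \<in> carrier_vec n" using assms by blast
  show "M j *\<^sub>v h j = A *\<^sub>v h i" if "j = Suc i"
    using assms *(2)[of i "h i"] hc[of i] that by (simp add: rational_iterate.simps)
qed

text \<open>The relation between \<open>h (Suc j)\<close> and \<open>h j\<close>, with the inverse
  cleared, is solved for \<open>A *\<^sub>v h (Suc j)\<close>. At an infinite pole the factor would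
  be the identity and the relation would say nothing about this vector.\<close>

lemma A_iterate:
  assumes "j < k"
  shows "A *\<^sub>v h (Suc j) = x (Suc j) \<cdot>\<^sub>v (h (Suc j) - A *\<^sub>v h j)"
proof -
  have hc: "h (Suc j) \<in> carrier_vec n" using assms by (intro iterate) auto
  have "h (Suc j) - (1 / x (Suc j)) \<cdot>\<^sub>v (A *\<^sub>v h (Suc j)) = A *\<^sub>v h j"
    using iterate(2)[of "Suc j" j] M_mult[OF assms hc] assms by simp
  then have *: "A *\<^sub>v h j = h (Suc j) - (1 / x (Suc j)) \<cdot>\<^sub>v (A *\<^sub>v h (Suc j))" ..
  have "a = x (Suc j) \<cdot>\<^sub>v (y - (y - (1 / x (Suc j)) \<cdot>\<^sub>v a))"
    if "y \<in> carrier_vec n" "a \<in> carrier_vec n" for y a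
    using that pole(1)[OF assms] by (intro eq_vecI) auto
  from this[OF hc A_mult[OF hc]] show ?thesis unfolding * .
qed

section \<open>Polynomials in A and ordinary Krylov spaces\<close>

lemma q_carrier [simp]: "q j \<in> carrier_mat n n"
  using A by (induction j) auto

lemma q_Suc_mult:
  "y \<in> carrier_vec n \<Longrightarrow> q (Suc j) *\<^sub>v y = q j *\<^sub>v (M (Suc j) *\<^sub>v y)"
  using assoc_mult_mat_vec[OF q_carrier M_carrier] by simp

lemma q_A:
  assumes "j \<le> k" "y \<in> carrier_vec n"
  shows "q j *\<^sub>v (A *\<^sub>v y) = A *\<^sub>v (q j *\<^sub>v y)"
  using assms
proof (induction j arbitrary: y)
  case 0
  then show ?case using A by simp
next
  case (Suc j)
  then have j: "j < k" by auto
  have "M (Suc j) *\<^sub>v (A *\<^sub>v y) = A *\<^sub>v (M (Suc j) *\<^sub>v y)"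
    using A Suc.prems by (simp add: M_mult[OF j] mult_minus_distrib_mat_vec[of _ n n] mult_mat_vec[of _ n n])
  moreover have "M (Suc j) *\<^sub>v y \<in> carrier_vec n"
    using mult_mat_vec_carrier[OF M_carrier Suc.prems(2)] .
  ultimately show ?case using Suc by (simp add: q_Suc_mult del: q_mat.simps)
qed

text \<open>\<open>q_mat\<close> appends factors on the right. Moving the newest one to the left
  makes it outermost, where \<open>M_kernel\<close> can cancel it or \<open>M_K\<close> can bound
  its effect.\<close>

lemma q_M:
  assumes "j < k" "y \<in> carrier_vec n"
  shows "q j *\<^sub>v (M (Suc j) *\<^sub>v y) = M (Suc j) *\<^sub>v (q j *\<^sub>v y)"
  using assms A mult_mat_vec_carrier[OF q_carrier assms(2)]
  by (simp add: M_mult mult_minus_distrib_mat_vec[of _ n n] mult_mat_vec[of _ n n] q_A)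

lemma q_kernel:
  "j \<le> k \<Longrightarrow> y \<in> carrier_vec n \<Longrightarrow> q j *\<^sub>v y = 0\<^sub>v n \<Longrightarrow> y = 0\<^sub>v n"
proof (induction j)
  case 0
  then show ?case using A by simp
next
  case (Suc j)
  have j: "j < k" using Suc.prems by auto
  have "M (Suc j) *\<^sub>v (q j *\<^sub>v y) = 0\<^sub>v n"
    using Suc.prems j by (simp add: q_M q_Suc_mult del: q_mat.simps)
  then show ?case
    using M_kernel Suc mult_mat_vec_carrier[OF q_carrier] by auto
qed

text \<open>\<open>pow_mat\<close> appends the new factor on the right, whereas the Krylov recursion
  multiplies by \<open>A\<close> from the left.\<close>

lemma power_b: "(A ^\<^sub>m Suc i) *\<^sub>v b = A *\<^sub>v ((A ^\<^sub>m i) *\<^sub>v b)"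
proof -
  have "A ^\<^sub>m Suc i = A * A ^\<^sub>m i"
  proof (induction i)
    case (Suc i)
    have "A ^\<^sub>m Suc (Suc i) = (A * A ^\<^sub>m i) * A" by (subst pow_mat.simps) (simp only: Suc)
    also have "\<dots> = A * A ^\<^sub>m Suc i"
      by (simp only: assoc_mult_mat[OF A pow_carrier_mat[OF A] A] pow_mat.simps)
    finally show ?case .
  qed (use A in simp)
  then show ?thesis using A b pow_carrier_mat[OF A, of i] by (simp add: assoc_mult_mat_vec[of _ n n _ n])
qed

lemma power_b_carrier [simp]: "(A ^\<^sub>m i) *\<^sub>v b \<in> carrier_vec n"
  using mult_mat_vec_carrier[OF pow_carrier_mat[OF A] b] .

lemma K_generators: "(\<lambda>i. (A ^\<^sub>m i) *\<^sub>v b) ` I \<subseteq> carrier_vec n"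
  by auto

text \<open>The factor \<open>M (Suc j)\<close> cancels the inverse in \<open>h (Suc j)\<close>, and
  \<open>q j\<close> commutes with the remaining \<open>A\<close>.\<close>

lemma q_iterate: "j \<le> k \<Longrightarrow> q j *\<^sub>v h j = (A ^\<^sub>m j) *\<^sub>v b"
proof (induction j)
  case 0
  then show ?case using A b by simp
next
  case (Suc j)
  have "q (Suc j) *\<^sub>v h (Suc j) = q j *\<^sub>v (A *\<^sub>v h j)"
    using Suc.prems iterate(1)[of "Suc j"] iterate(2)[of "Suc j" j] by (simp only: q_Suc_mult)
  also have "\<dots> = A *\<^sub>v ((A ^\<^sub>m j) *\<^sub>v b)" using Suc iterate(1)[of j] by (simp add: q_A)
  finally show ?case by (simp only: power_b)
qed

text \<open>In polynomial terms, multiplication by 1 - z/\<xi> raises the degree by at most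
  one.\<close>

lemma M_K: 
  assumes "j < k" "y \<in> K m"
  shows "M (Suc j) *\<^sub>v y \<in> K (Suc m)"
  using K_generators assms(2)
proof (induction rule: vec_span_induct)
  case (base y)
  then obtain i where i: "i < m" "y = (A ^\<^sub>m i) *\<^sub>v b" by auto
  have "y - (1 / x (Suc j)) \<cdot>\<^sub>v ((A ^\<^sub>m Suc i) *\<^sub>v b) \<in> K (Suc m)"
    using i by (intro vec_span_diff vec_span_smult vec_span_base K_generators) (auto simp del: pow_mat.simps)
  then show ?case using i M_mult[OF assms(1), of y] by (simp only: power_b power_b_carrier)
next
  case zero
  have "M (Suc j) *\<^sub>v 0\<^sub>v n = 0\<^sub>v n" by (rule mult_mat_zero_vec[OF M_carrier])
  then show ?case by (metis K_generators vec_span_zero)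
next
  case (add y z)
  then have "y \<in> carrier_vec n" "z \<in> carrier_vec n" using vec_span_closed[OF K_generators] by auto
  then show ?case using add by (simp add: mult_add_distrib_mat_vec[of _ n n] vec_span_add[OF K_generators])
next
  case (smult y c)
  then have "y \<in> carrier_vec n" using vec_span_closed[OF K_generators] by auto
  then show ?case using smult by (simp add: mult_mat_vec[of _ n n] vec_span_smult[OF K_generators])
qed

text \<open>For \<open>j = i\<close> this is a Krylov generator by \<open>q_iterate\<close>; every
  further factor of \<open>q\<close> raises the degree by at most one.\<close>

lemma q_iterate_in_K: "i \<le> j \<Longrightarrow> j \<le> k \<Longrightarrow> q j *\<^sub>v h i \<in> K (Suc j)"
proof (induction j rule: dec_induct)
  case base
  then show ?case by (auto simp: q_iterate intro!: vec_span_base K_generators)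
next
  case (step j)
  then show ?case using M_K[of j "q j *\<^sub>v h i"] iterate(1)[of i]
    by (simp add: q_Suc_mult q_M del: q_mat.simps)
qed

text \<open>Since \<open>A\<^sup>i b = M (A\<^sup>i b) + A\<^sup>i\<^sup>+\<^sup>1 b / \<xi>\<close>, the generators are handled from the highest power
  downwards.\<close>

lemma K_decomp:
  assumes "j < k" "y \<in> K (Suc m)"
  shows "\<exists>z\<in>K m. \<exists>c. y = M (Suc j) *\<^sub>v z + c \<cdot>\<^sub>v ((A ^\<^sub>m m) *\<^sub>v b)"
proof -
  let ?a = "\<lambda>i. (A ^\<^sub>m i) *\<^sub>v b"
  note S = K_generators[of "{..<m}"]
  let ?P = "\<lambda>y. \<exists>z\<in>K m. \<exists>c. y = M (Suc j) *\<^sub>v z + c \<cdot>\<^sub>v ?a m"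
  have Mc: "M (Suc j) *\<^sub>v z \<in> carrier_vec n" if "z \<in> carrier_vec n" for z
    using mult_mat_vec_carrier[OF M_carrier that] .
  \<comment> \<open>\<open>?P\<close> is first shown to define a subspace, because the generators
    below are themselves combined from earlier ones.\<close>
  have zero: "?P (0\<^sub>v n)"
  proof (intro bexI exI)
    show "0\<^sub>v n = M (Suc j) *\<^sub>v 0\<^sub>v n + 0 \<cdot>\<^sub>v ?a m"
      unfolding mult_mat_zero_vec[OF M_carrier] using power_b_carrier[of m]
      by (intro eq_vecI) (auto simp del: power_b_carrier index_mult_mat_vec dim_mult_mat_vec)
  qed (rule vec_span_zero[OF S])
  have add: "?P (y + y')" if "?P y" "?P y'" for y y'
  proof -
    from that obtain z c z' c' where *: "z \<in> K m" "y = M (Suc j) *\<^sub>v z + c \<cdot>\<^sub>v ?a m"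
      "z' \<in> K m" "y' = M (Suc j) *\<^sub>v z' + c' \<cdot>\<^sub>v ?a m" by blast
    then have zz: "z \<in> carrier_vec n" "z' \<in> carrier_vec n" using vec_span_closed[OF S] by auto
    show ?thesis
    proof (intro bexI exI)
      show "y + y' = M (Suc j) *\<^sub>v (z + z') + (c + c') \<cdot>\<^sub>v ?a m"
        unfolding * mult_add_distrib_mat_vec[OF M_carrier zz]
        using Mc[OF zz(1)] Mc[OF zz(2)] power_b_carrier[of m]
        by (intro eq_vecI) (auto simp: algebra_simps simp del: index_mult_mat_vec dim_mult_mat_vec power_b_carrier)
    qed (rule vec_span_add[OF S *(1,3)])
  qed
  have smult: "?P (d \<cdot>\<^sub>v y)" if "?P y" for y d
  proof -
    from that obtain z c where *: "z \<in> K m" "y = M (Suc j) *\<^sub>v z + c \<cdot>\<^sub>v ?a m" by blast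
    then have zz: "z \<in> carrier_vec n" using vec_span_closed[OF S] by auto
    show ?thesis
    proof (intro bexI exI)
      show "d \<cdot>\<^sub>v y = M (Suc j) *\<^sub>v (d \<cdot>\<^sub>v z) + (d * c) \<cdot>\<^sub>v ?a m"
        unfolding * mult_mat_vec[OF M_carrier zz]
        using Mc[OF zz] power_b_carrier[of m]
        by (intro eq_vecI) (auto simp: algebra_simps simp del: index_mult_mat_vec dim_mult_mat_vec power_b_carrier)
    qed (rule vec_span_smult[OF S *(1)])
  qed
  have gen: "?P (?a i)" if "i \<le> m" for i
    using that
  proof (induction i rule: inc_induct)
    case base
    show ?case
    proof (intro bexI exI)
      show "?a m = M (Suc j) *\<^sub>v 0\<^sub>v n + 1 \<cdot>\<^sub>v ?a m"
        unfolding mult_mat_zero_vec[OF M_carrier] using power_b_carrier[of m]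
        by (intro eq_vecI) (auto simp del: power_b_carrier index_mult_mat_vec dim_mult_mat_vec)
    qed (rule vec_span_zero[OF S])
  next
    case (step i)
    have "?P (M (Suc j) *\<^sub>v ?a i)"
    proof (intro bexI exI)
      show "M (Suc j) *\<^sub>v ?a i = M (Suc j) *\<^sub>v ?a i + 0 \<cdot>\<^sub>v ?a m"
        using Mc[OF power_b_carrier[of i]] power_b_carrier[of m]
        by (intro eq_vecI) (auto simp del: index_mult_mat_vec dim_mult_mat_vec power_b_carrier)
    qed (use step in \<open>auto intro: vec_span_base[OF S]\<close>)
    from add[OF this smult[OF step.IH]]
    have "?P (M (Suc j) *\<^sub>v ?a i + (1 / x (Suc j)) \<cdot>\<^sub>v ?a (Suc i))" .
    moreover have "M (Suc j) *\<^sub>v ?a i + (1 / x (Suc j)) \<cdot>\<^sub>v ?a (Suc i) = ?a i"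
      unfolding M_mult[OF assms(1) power_b_carrier] power_b
      using power_b_carrier[of i] A_mult[OF power_b_carrier[of i]]
      by (intro eq_vecI)
        (auto simp del: index_mult_mat_vec dim_mult_mat_vec power_b_carrier A_mult)
    ultimately show ?case by (simp only:)
  qed
  show ?thesis
    using K_generators assms(2)
  proof (induction rule: vec_span_induct)
    case (base y)
    then obtain i where "i \<le> m" "y = ?a i" by (auto simp: less_Suc_eq_le)
    then show ?case using gen by simp
  qed (use zero add smult in auto)
qed

text \<open>Induction by polynomial division: \<open>K_decomp\<close> splits off a multiple of the
  top power, which is the image of a multiple of \<open>h (Suc j)\<close> under
  \<open>q (Suc j)\<close>. After subtracting it, one pole factor cancels and the degree bound drops
  by one.\<close>

lemma q_in_K:
  assumes "j \<le> k" "y \<in> carrier_vec n" "q j *\<^sub>v y \<in> K (Suc j)"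
  shows "y \<in> vec_span n (h ` {..j})"
  using assms
proof (induction j arbitrary: y)
  case 0
  then show ?case using A b by (simp add: lessThan_Suc)
next
  case (Suc j)
  have j: "j < k" using Suc.prems by auto
  have H: "h ` {..Suc j} \<subseteq> carrier_vec n" using Suc.prems iterate(1) by auto
  have hc: "h (Suc j) \<in> carrier_vec n" using H by blast
  obtain z c where z: "z \<in> K (Suc j)"
    and y: "q (Suc j) *\<^sub>v y = M (Suc j) *\<^sub>v z + c \<cdot>\<^sub>v ((A ^\<^sub>m Suc j) *\<^sub>v b)"
    using K_decomp[OF j Suc.prems(3)] by blast
  have zc: "z \<in> carrier_vec n" using z vec_span_closed[OF K_generators] by blast
  let ?y = "y - c \<cdot>\<^sub>v h (Suc j)"
  have yc: "?y \<in> carrier_vec n" using Suc.prems hc by auto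
  have qy: "q j *\<^sub>v ?y \<in> carrier_vec n" using mult_mat_vec_carrier[OF q_carrier yc] .
  have Mz: "M (Suc j) *\<^sub>v z \<in> carrier_vec n" using mult_mat_vec_carrier[OF M_carrier zc] .
  have "M (Suc j) *\<^sub>v (q j *\<^sub>v ?y) = q (Suc j) *\<^sub>v ?y"
    using yc j by (simp only: q_M q_Suc_mult)
  also have "\<dots> = q (Suc j) *\<^sub>v y - c \<cdot>\<^sub>v (q (Suc j) *\<^sub>v h (Suc j))"
    using Suc.prems(2) hc
    by (simp only: mult_minus_distrib_mat_vec[OF q_carrier] mult_mat_vec[OF q_carrier]
        smult_carrier_vec)
  also have "\<dots> = M (Suc j) *\<^sub>v z"
    unfolding y q_iterate[OF Suc.prems(1)] using Mz power_b_carrier[of "Suc j"]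
    by (rule add_smult_diff)
  finally have "M (Suc j) *\<^sub>v (q j *\<^sub>v ?y - z) = 0\<^sub>v n"
    using Mz by (simp only: mult_minus_distrib_mat_vec[OF M_carrier qy zc] minus_cancel_vec[OF Mz])
  then have "q j *\<^sub>v ?y - z = 0\<^sub>v n" using M_kernel qy zc by auto
  moreover have "q j *\<^sub>v ?y = (q j *\<^sub>v ?y - z) + z"
    using qy zc by (intro eq_vecI) (auto simp del: index_mult_mat_vec dim_mult_mat_vec)
  ultimately have "q j *\<^sub>v ?y = z" using zc by simp
  with z have "?y \<in> vec_span n (h ` {..j})"
    using Suc.IH[OF _ yc] j by simp
  then have "?y \<in> vec_span n (h ` {..Suc j})"
    by (rule subsetD[OF vec_span_mono[OF H image_mono], rotated]) simp
  moreover have "h (Suc j) \<in> vec_span n (h ` {..Suc j})"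
    by (rule vec_span_base[OF H]) simp
  ultimately have "?y + c \<cdot>\<^sub>v h (Suc j) \<in> vec_span n (h ` {..Suc j})"
    by (rule vec_span_add[OF H _ vec_span_smult[OF H]])
  moreover have "?y + c \<cdot>\<^sub>v h (Suc j) = y"
    using Suc.prems hc by (intro eq_vecI) (auto)
  ultimately show ?case by simp
qed

text \<open>As \<open>q j\<close> is invertible, \<open>y\<close> lies in the left-hand side iff
  \<open>q j *\<^sub>v y\<close> lies in \<open>K (Suc j)\<close>. The inclusions are then
  \<open>q_in_K\<close> and, checked on generators, \<open>q_iterate_in_K\<close>.\<close>

lemma rational_krylov_eq:
  assumes "j \<le> k"
  shows "rational_krylov A b \<xi> (Suc j) = vec_span n (h ` {..j})"
proof -
  note R = minv_mult[OF q_carrier[of j] q_kernel[OF assms]]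
  have K: "krylov A b (Suc j) = K (Suc j)"
    using A unfolding krylov_def by (auto intro!: arg_cong[where f = "vec_span n"])
  have H: "h ` {..j} \<subseteq> carrier_vec n" using assms iterate(1) by auto
  show ?thesis
  proof (intro equalityI subsetI)
    fix y assume "y \<in> rational_krylov A b \<xi> (Suc j)"
    then obtain z where z: "z \<in> K (Suc j)" "y = minv (q j) *\<^sub>v z"
      unfolding rational_krylov_def K by auto
    have zc: "z \<in> carrier_vec n" using z vec_span_closed[OF K_generators] by blast
    have "q j *\<^sub>v y = z" using z(2) zc R assoc_mult_mat_vec[OF q_carrier R(1) zc, of j] by simp
    moreover have "y \<in> carrier_vec n" using z(2) R(1) zc by auto
    ultimately show "y \<in> vec_span n (h ` {..j})" using z(1) assms by (intro q_in_K) auto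
  next
    fix y assume y: "y \<in> vec_span n (h ` {..j})"
    have yc: "y \<in> carrier_vec n" using vec_span_closed[OF H y] .
    have "q j *\<^sub>v y \<in> K (Suc j)"
      using H y
    proof (induction rule: vec_span_induct)
      case (base y)
      then show ?case using assms q_iterate_in_K by auto
    next
      case zero
      have "q j *\<^sub>v 0\<^sub>v n = 0\<^sub>v n" by (rule mult_mat_zero_vec[OF q_carrier])
      then show ?case by (metis K_generators vec_span_zero)
    next
      case (add y z)
      then have "y \<in> carrier_vec n" "z \<in> carrier_vec n" using vec_span_closed[OF H] by auto
      then show ?case using add
        by (simp add: mult_add_distrib_mat_vec[OF q_carrier] vec_span_add[OF K_generators])
    next
      case (smult y c)
      then have "y \<in> carrier_vec n" using vec_span_closed[OF H] by auto
      then show ?case using smult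
        by (simp add: mult_mat_vec[OF q_carrier] vec_span_smult[OF K_generators])
    qed
    moreover have "minv (q j) *\<^sub>v (q j *\<^sub>v y) = y"
      using yc R assoc_mult_mat_vec[OF R(1) q_carrier[of j] yc] by simp
    ultimately show "y \<in> rational_krylov A b \<xi> (Suc j)"
      unfolding rational_krylov_def K by (metis diff_Suc_1 imageI)
  qed
qed

end

section \<open>The Arnoldi vectors\<close>

text \<open>A nonzero \<open>b\<close> lets the first vector be normalized; in the theorem it is
  derived from the bound on the invariance index.\<close>

locale rational_arnoldi = finite_poles +
  assumes sym: "transpose_mat A = A"
    and no_breakdown: "arnoldi_no_breakdown A b \<xi> k"
    and nonzero: "b \<noteq> 0\<^sub>v n"
begin

definition v :: "nat \<Rightarrow> real vec" where
  "v j = last (arnoldi_vecs A b \<xi> j)"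

lemma arnoldi_vecs_eq: "arnoldi_vecs A b \<xi> j = map v [0..<Suc j]"
proof (induction j)
  case 0
  show ?case by (simp add: v_def)
next
  case (Suc j)
  have "arnoldi_vecs A b \<xi> (Suc j) = arnoldi_vecs A b \<xi> j @ [v (Suc j)]"
    by (simp add: v_def Let_def)
  with Suc show ?case by simp
qed

lemma v_Suc:
  "v (Suc j) = orthonormalize (map v [0..<Suc j]) (arnoldi_continuation A (\<xi> (Suc j)) (v j))"
proof -
  have "v (Suc j) =
      orthonormalize (arnoldi_vecs A b \<xi> j) (arnoldi_continuation A (\<xi> (Suc j)) (v j))"
    by (simp add: v_def Let_def)
  then show ?thesis by (simp only: arnoldi_vecs_eq)
qed

lemma continuation_in:
  assumes "j < k"
  shows "arnoldi_continuation A (\<xi> (Suc j)) (v j) \<in>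
    vec_span n (h ` {..Suc j}) - vec_span n (h ` {..j})"
proof -
  have "arnoldi_continuation A (\<xi> (Suc j)) (v j) \<in>
      rational_krylov A b \<xi> (Suc (Suc j)) - rational_krylov A b \<xi> (Suc j)"
    using no_breakdown[unfolded arnoldi_no_breakdown_def, rule_format, of "Suc j"] assms
    by (simp add: v_def)
  then show ?thesis using assms rational_krylov_eq[of "Suc j"] rational_krylov_eq[of j]
    by (simp)
qed

lemma H: "j \<le> k \<Longrightarrow> h ` {..j} \<subseteq> carrier_vec n"
  using iterate(1) by auto

text \<open>The vectors \<open>v\<close> and \<open>h\<close> are triangular combinations of each
  other. The claims are proved together: orthogonality of the new vector needs the earlier
  orthonormality, and each change of basis needs the other one at the previous indices.\<close>

lemma arnoldi_basis:
  assumes "j \<le> k"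
  shows "(\<forall>i\<le>j. v i \<in> vec_span n (h ` {..i})) \<and>
    (\<forall>i\<le>j. \<forall>l\<le>j. v i \<bullet> v l = (if i = l then 1 else 0)) \<and>
    (\<forall>i\<le>j. h i \<in> vec_span n (v ` {..i}))"
  using assms
proof (induction j)
  case 0
  have v0: "v 0 = (1 / norm2 b) \<cdot>\<^sub>v b" by (simp add: v_def)
  have "b = norm2 b \<cdot>\<^sub>v v 0"
    using norm2_normalized[OF b nonzero] b unfolding v0 by (intro eq_vecI) auto
  moreover have "norm2 b \<cdot>\<^sub>v v 0 \<in> vec_span n {v 0}"
    by (intro vec_span_smult vec_span_base) (auto simp: v0 b)
  ultimately show ?case
    using b norm2_normalized[OF b nonzero] vec_span_smult[of "{b}" n, OF _ vec_span_base]
    by (auto simp: v0)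
next
  case (Suc j)
  have j: "j < k" using Suc.prems by auto
  note IH = Suc.IH[OF less_imp_le[OF j]]
  let ?w = "arnoldi_continuation A (\<xi> (Suc j)) (v j)"
  let ?N = "Suc j"
  define r where "r = residual v ?w ?N"
  note HS = H[OF Suc.prems] and Hj = H[OF less_imp_le[OF j]]
  have wS: "?w \<in> vec_span n (h ` {..Suc j})" and wj: "?w \<notin> vec_span n (h ` {..j})"
    using continuation_in[OF j] by auto
  have w: "?w \<in> carrier_vec n" using vec_span_closed[OF HS wS] .
  have vH: "v i \<in> vec_span n (h ` {..j})" if "i \<le> j" for i
    using IH that by (intro subsetD[OF vec_span_mono[OF Hj, of "h ` {..i}"]]) auto
  have vc: "v i \<in> carrier_vec n" if "i < ?N" for i
    using vec_span_closed[OF Hj vH] that by auto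
  have V: "v ` {..<?N} \<subseteq> carrier_vec n" using vc by auto
  have VH: "vec_span n (v ` {..<?N}) \<subseteq> vec_span n (h ` {..j})"
    using vH by (intro vec_span_subset V Hj) auto
  have HH: "vec_span n (h ` {..j}) \<subseteq> vec_span n (h ` {..Suc j})"
    by (rule vec_span_mono[OF HS]) auto
  have rc: "r \<in> carrier_vec n"
    unfolding r_def by (rule residual_carrier[where N = ?N]) (use vc w in auto)
  have wr: "?w - r \<in> vec_span n (v ` {..<?N})"
    unfolding r_def by (rule residual_diff) (use vc w in auto)
  have orth: "v l \<bullet> r = 0" if "l \<le> j" for l
    using residual_orthogonal[of ?N v n ?w ?N l] vc w IH that by (auto simp: r_def less_Suc_eq_le)
  \<comment> \<open>Without breakdown the continuation leaves the old space, so its residual cannot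
    vanish.\<close>
  have "r \<noteq> 0\<^sub>v n"
  proof
    assume "r = 0\<^sub>v n"
    with wr w VH have "?w \<in> vec_span n (h ` {..j})" by auto
    with wj show False ..
  qed
  note norm = norm2_normalized[OF rc this]
  have vS: "v (Suc j) = (1 / norm2 r) \<cdot>\<^sub>v r"
    unfolding v_Suc orthonormalize_def r_def residual_def by (simp only: Let_def)
  have vSc: "v (Suc j) \<in> carrier_vec n" using rc by (simp add: vS)
  have orthS: "v l \<bullet> v (Suc j) = 0" "v (Suc j) \<bullet> v l = 0" if "l \<le> j" for l
    using orth[OF that] vc[of l] rc that
    by (auto simp: vS comm_scalar_prod[of "v l" n r])
  have "r = ?w - (?w - r)" using w rc by (intro eq_vecI) auto
  also have "\<dots> \<in> vec_span n (h ` {..Suc j})"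
    by (rule vec_span_diff[OF HS wS subsetD[OF HH subsetD[OF VH wr]]])
  finally have vSH: "v (Suc j) \<in> vec_span n (h ` {..Suc j})"
    unfolding vS by (rule vec_span_smult[OF HS])
  have VS: "v ` {..Suc j} \<subseteq> carrier_vec n" using V vSc by (auto simp: atMost_Suc lessThan_Suc_atMost)
  have "h ` {..Suc j} = insert (h (Suc j)) (h ` {..j})" by (simp add: atMost_Suc)
  with wS HS obtain c y where y: "y \<in> vec_span n (h ` {..j})" and wy: "?w = y + c \<cdot>\<^sub>v h (Suc j)"
    by (metis vec_span_insertE)
  have yc: "y \<in> carrier_vec n" and hc: "h (Suc j) \<in> carrier_vec n"
    using vec_span_closed[OF Hj y] HS by blast+
  \<comment> \<open>The same non-membership gives a nonzero coefficient of \<open>h (Suc j)\<close>,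
    so this iterate can be solved for.\<close>
  have "c \<noteq> 0"
  proof
    assume "c = 0"
    then have "?w = y" using wy yc hc by (intro eq_vecI) (auto)
    with wj y show False by simp
  qed
  have HV: "vec_span n (h ` {..j}) \<subseteq> vec_span n (v ` {..Suc j})"
  proof (rule vec_span_subset[OF Hj VS])
    fix z assume "z \<in> h ` {..j}"
    then obtain i where "i \<le> j" "z = h i" by auto
    then show "z \<in> vec_span n (v ` {..Suc j})"
      using IH by (intro subsetD[OF vec_span_mono[OF VS, of "v ` {..i}"]]) auto
  qed
  \<comment> \<open>Two expressions for \<open>?w - y\<close> are compared: one in the Arnoldi
    vectors, with \<open>r\<close> written as its norm times \<open>v (Suc j)\<close>, the other a
    multiple of \<open>h (Suc j)\<close>.\<close>
  have "?w - y = (?w - r) + norm2 r \<cdot>\<^sub>v v (Suc j) - y"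
    using w rc yc norm(1) by (intro eq_vecI) (auto simp: vS)
  moreover have "?w - y = c \<cdot>\<^sub>v h (Suc j)"
    unfolding wy using yc hc by (intro eq_vecI) (auto)
  moreover have "(?w - r) + norm2 r \<cdot>\<^sub>v v (Suc j) - y \<in> vec_span n (v ` {..Suc j})"
  proof (rule vec_span_diff[OF VS vec_span_add[OF VS _ vec_span_smult[OF VS]]])
    show "?w - r \<in> vec_span n (v ` {..Suc j})"
      by (rule subsetD[OF vec_span_mono[OF VS image_mono] wr]) auto
    show "v (Suc j) \<in> vec_span n (v ` {..Suc j})" by (rule vec_span_base[OF VS]) auto
    show "y \<in> vec_span n (v ` {..Suc j})" using y HV by auto
  qed
  ultimately have "c \<cdot>\<^sub>v h (Suc j) \<in> vec_span n (v ` {..Suc j})" by (simp only:)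
  then have "(1 / c) \<cdot>\<^sub>v (c \<cdot>\<^sub>v h (Suc j)) \<in> vec_span n (v ` {..Suc j})"
    by (rule vec_span_smult[OF VS])
  then have "h (Suc j) \<in> vec_span n (v ` {..Suc j})"
    using \<open>c \<noteq> 0\<close> by (simp add: smult_smult_assoc)
  moreover have "v (Suc j) \<bullet> v (Suc j) = 1" using norm(2) by (simp only: vS)
  ultimately show ?case
    using IH orthS vSH by (auto simp: le_Suc_eq)
qed

lemma v_in: "i \<le> k \<Longrightarrow> v i \<in> vec_span n (h ` {..i})"
  and v_orthonormal: "i \<le> k \<Longrightarrow> l \<le> k \<Longrightarrow> v i \<bullet> v l = (if i = l then 1 else 0)"
  and iterate_in: "i \<le> k \<Longrightarrow> h i \<in> vec_span n (v ` {..i})"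
  using arnoldi_basis[OF order_refl] by auto

lemma v_carrier: "i \<le> k \<Longrightarrow> v i \<in> carrier_vec n"
  using vec_span_closed[OF H v_in] .

text \<open>\<open>h l\<close> is a combination of the vectors up to \<open>v l\<close>, all of them
  orthogonal to \<open>v i\<close>.\<close>

lemma v_iterate_orthogonal:
  assumes "l < i" "i \<le> k"
  shows "v i \<bullet> h l = 0"
proof -
  have V: "v ` {..l} \<subseteq> carrier_vec n" using assms v_carrier by auto
  have "h l \<in> vec_span n (v ` {..l})" using iterate_in assms by auto
  with V show ?thesis
  proof (induction rule: vec_span_induct)
    case (base y)
    then show ?case using v_orthonormal[of i] assms by auto
  next
    case zero
    show ?case using v_carrier assms by auto
  next
    case (add y z)
    then show ?case
      using vec_span_closed[OF V] v_carrier[OF assms(2)] by (auto simp: scalar_prod_add_distrib[of _ n])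
  next
    case (smult y c)
    then show ?case using vec_span_closed[OF V] v_carrier[OF assms(2)] by auto
  qed
qed

section \<open>Entries of the projected matrix on and below the diagonal\<close>

abbreviation "d i \<equiv> if i = 0 then 0 else x i"

text \<open>While \<open>Suc l < i\<close>, the term with \<open>h (Suc l)\<close> in
  \<open>A_iterate\<close> is orthogonal to \<open>v i\<close>; at \<open>Suc l = i\<close> it
  leaves the diagonal summand. No pole enters for \<open>h 0 = b\<close>, hence
  \<open>d 0 = 0\<close>.\<close>

lemma v_A_iterate:
  assumes "l \<le> i" "i \<le> k"
  shows "v i \<bullet> (A *\<^sub>v h l) =
    (v i \<bullet> (A *\<^sub>v b)) * (\<Prod>m=1..l. - x m) + (if i = l then d l * (v i \<bullet> h l) else 0)"
  using assms
proof (induction l)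
  case (Suc l)
  have l: "l < k" "l \<noteq> i" "l \<le> i" using Suc.prems by auto
  have c: "v i \<in> carrier_vec n" "h (Suc l) \<in> carrier_vec n" "A *\<^sub>v h l \<in> carrier_vec n"
    using v_carrier iterate(1) Suc.prems by auto
  have "v i \<bullet> (A *\<^sub>v h (Suc l)) = x (Suc l) * (v i \<bullet> h (Suc l) - v i \<bullet> (A *\<^sub>v h l))"
    unfolding A_iterate[OF l(1)] using c
    by (simp add: scalar_prod_minus_distrib[of _ n])
  then show ?case
    using Suc.IH l Suc.prems v_iterate_orthogonal[of "Suc l" i]
    by (cases "i = Suc l") (simp_all add: algebra_simps)
qed simp

text \<open>The point is that \<open>\<omega>\<close> depends on \<open>y\<close> but not on
  \<open>i\<close>, which is what makes a column a multiple of a fixed vector. The claim is linear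
  in \<open>y\<close>, so generators suffice.\<close>

lemma v_A_span:
  assumes "j \<le> k" "y \<in> vec_span n (h ` {..j})"
  shows "\<exists>\<omega>. \<forall>i. j \<le> i \<longrightarrow> i \<le> k \<longrightarrow>
    v i \<bullet> (A *\<^sub>v y) = (v i \<bullet> (A *\<^sub>v b)) * \<omega> + (if i = j then d j * (v i \<bullet> y) else 0)"
  using H[OF assms(1)] assms(2)
proof (induction rule: vec_span_induct)
  case (base y)
  then obtain l where l: "l \<le> j" "y = h l" by auto
  show ?case
  proof (intro exI allI impI)
    fix i assume i: "j \<le> i" "i \<le> k"
    \<comment> \<open>If \<open>l < j = i\<close>, the extra summand is zero by orthogonality; if
      \<open>l = j\<close>, it is the one from \<open>v_A_iterate\<close>.\<close>
    show "v i \<bullet> (A *\<^sub>v y) = (v i \<bullet> (A *\<^sub>v b)) * (\<Prod>m=1..l. - x m) +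
        (if i = j then d j * (v i \<bullet> y) else 0)"
      using v_A_iterate[of l i] v_iterate_orthogonal[of l i] i l by auto
  qed
next
  case zero
  have "A *\<^sub>v 0\<^sub>v n = 0\<^sub>v n" using mult_mat_zero_vec[OF A] .
  then show ?case using v_carrier by (intro exI[of _ 0]) auto
next
  case (add y z)
  have c: "y \<in> carrier_vec n" "z \<in> carrier_vec n" using add vec_span_closed[OF H[OF assms(1)]] by auto
  from add obtain \<omega> \<omega>' where
    "\<forall>i. j \<le> i \<longrightarrow> i \<le> k \<longrightarrow>
      v i \<bullet> (A *\<^sub>v y) = (v i \<bullet> (A *\<^sub>v b)) * \<omega> + (if i = j then d j * (v i \<bullet> y) else 0)"
    "\<forall>i. j \<le> i \<longrightarrow> i \<le> k \<longrightarrow>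
      v i \<bullet> (A *\<^sub>v z) = (v i \<bullet> (A *\<^sub>v b)) * \<omega>' + (if i = j then d j * (v i \<bullet> z) else 0)"
    by blast
  then show ?case using c v_carrier
    by (intro exI[of _ "\<omega> + \<omega>'"])
      (auto simp: mult_add_distrib_mat_vec[OF A] scalar_prod_add_distrib[of _ n] algebra_simps)
next
  case (smult y c)
  have y: "y \<in> carrier_vec n" using smult vec_span_closed[OF H[OF assms(1)]] by auto
  from smult obtain \<omega> where
    "\<forall>i. j \<le> i \<longrightarrow> i \<le> k \<longrightarrow>
      v i \<bullet> (A *\<^sub>v y) = (v i \<bullet> (A *\<^sub>v b)) * \<omega> + (if i = j then d j * (v i \<bullet> y) else 0)"
    by blast
  moreover have "v i \<bullet> (A *\<^sub>v (c \<cdot>\<^sub>v y)) = c * (v i \<bullet> (A *\<^sub>v y))" "v i \<bullet> (c \<cdot>\<^sub>v y) = c * (v i \<bullet> y)"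
    if "i \<le> k" for i
    unfolding mult_mat_vec[OF A y] using v_carrier[OF that] y by simp_all
  ultimately show ?case by (intro exI[of _ "c * \<omega>"]) (simp add: algebra_simps)
qed

text \<open>One \<open>\<omega>\<close> is chosen per column, and normalization of
  \<open>v j\<close> reduces the diagonal summand to \<open>d j\<close>.\<close>

lemma generators:
  obtains \<omega> where "\<And>i j. j \<le> i \<Longrightarrow> i \<le> k \<Longrightarrow>
    v i \<bullet> (A *\<^sub>v v j) = (v i \<bullet> (A *\<^sub>v b)) * \<omega> j + (if i = j then d j else 0)"
proof -
  have "\<forall>j. \<exists>\<omega>. j \<le> k \<longrightarrow> (\<forall>i. j \<le> i \<longrightarrow> i \<le> k \<longrightarrow>
    v i \<bullet> (A *\<^sub>v v j) = (v i \<bullet> (A *\<^sub>v b)) * \<omega> + (if i = j then d j * (v i \<bullet> v j) else 0))"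
    using v_A_span v_in by blast
  then obtain \<omega> where \<omega>: "\<forall>j\<le>k. \<forall>i. j \<le> i \<longrightarrow> i \<le> k \<longrightarrow>
    v i \<bullet> (A *\<^sub>v v j) = (v i \<bullet> (A *\<^sub>v b)) * \<omega> j + (if i = j then d j * (v i \<bullet> v j) else 0)"
    by (elim choice[THEN exE]) blast
  show thesis
  proof (rule that)
    fix i j assume "j \<le> i" "i \<le> k"
    then show "v i \<bullet> (A *\<^sub>v v j) = (v i \<bullet> (A *\<^sub>v b)) * \<omega> j + (if i = j then d j else 0)"
      using \<omega>[rule_format, of j i] v_orthonormal[of i j] by auto
  qed
qed

lemma A_symmetric:
  assumes "y \<in> carrier_vec n" "z \<in> carrier_vec n"
  shows "y \<bullet> (A *\<^sub>v z) = z \<bullet> (A *\<^sub>v y)"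
proof -
  have "y \<bullet> (A *\<^sub>v z) = (transpose_mat A *\<^sub>v y) \<bullet> z"
    using transpose_vec_mult_scalar[OF A assms(2,1)] by simp
  then show ?thesis using assms by (simp add: sym comm_scalar_prod[of _ n])
qed

lemma arnoldi_mat_carrier: "arnoldi_mat A b \<xi> k \<in> carrier_mat n (k + 1)"
proof -
  have "length (arnoldi_vecs A b \<xi> k) = k + 1" by (simp add: arnoldi_vecs_eq del: upt_Suc)
  then show ?thesis
    unfolding arnoldi_mat_def carrier_matD(1)[OF A] by (metis mat_of_cols_carrier(1))
qed

lemma projection_index:
  assumes "i < k + 1" "j < k + 1"
  shows "(transpose_mat (arnoldi_mat A b \<xi> k) * A * arnoldi_mat A b \<xi> k) $$ (i, j) = v i \<bullet> (A *\<^sub>v v j)"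
proof -
  let ?Q = "arnoldi_mat A b \<xi> k"
  have col: "col ?Q i = v i" if "i < k + 1" for i
  proof -
    have "arnoldi_vecs A b \<xi> k ! i = v i" "i < length (arnoldi_vecs A b \<xi> k)"
      using that by (simp_all add: arnoldi_vecs_eq del: upt_Suc)
    then show ?thesis
      unfolding arnoldi_mat_def carrier_matD(1)[OF A] using that v_carrier[of i] by simp
  qed
  have Q: "?Q \<in> carrier_mat n (k + 1)" by (rule arnoldi_mat_carrier)
  then have "transpose_mat ?Q * A * ?Q = transpose_mat ?Q * (A * ?Q)"
    by (intro assoc_mult_mat[OF _ A Q]) simp
  moreover have "col (A * ?Q) j = A *\<^sub>v v j" using col_mult2[OF A Q assms(2)] col[OF assms(2)] by simp
  ultimately show ?thesis using Q A assms col[OF assms(1)] by simp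
qed

end

section \<open>Semiseparability\<close>

lemma rank_product_entries:
  assumes "\<And>i j. i < dim_row M \<Longrightarrow> j < dim_col M \<Longrightarrow> M $$ (i, j) = f i * g j"
  shows "mat_rank M \<le> 1"
proof -
  interpret vec_space "TYPE(real)" "dim_row M" .
  show ?thesis using assms by (intro rank_le_1_product_entries[where nc = "dim_col M"]) auto
qed

text \<open>Rows from \<open>i\<close> on and columns up to \<open>i\<close> meet only in the lower
  triangle with diagonal, where entries factor, so the block has rank at most one; the upper blocks
  are analogous.\<close>

lemma generator_representable_semiseparableI:
  assumes S: "S \<in> carrier_mat N N"
    and lower: "\<And>i j. j \<le> i \<Longrightarrow> i < N \<Longrightarrow> S $$ (i, j) = u i * w j"
    and upper: "\<And>i j. i \<le> j \<Longrightarrow> j < N \<Longrightarrow> S $$ (i, j) = p i * q j"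
  shows "generator_representable_semiseparable N S"
proof -
  \<comment> \<open>\<open>pick\<close> turns positions in a submatrix into original indices; these
    bounds place the block inside its triangle.\<close>
  have pick_low: "pick {0..i} r \<le> i" if "i < N" "r < card {j. j < N \<and> j \<in> {0..i}}" for i r
  proof -
    have "{j. j < N \<and> j \<in> {0..i}} = {0..i}" using that(1) by auto
    then show ?thesis using that(2) pick_in_set_le[of r "{0..i}"] by auto
  qed
  have pick_high: "i \<le> pick {i..<N} r \<and> pick {i..<N} r < N" if "r < card {j. j < N \<and> j \<in> {i..<N}}" for i r
  proof -
    have "{j. j < N \<and> j \<in> {i..<N}} = {i..<N}" by auto
    then show ?thesis using that pick_in_set_le[of r "{i..<N}"] by auto
  qed
  have "mat_rank (submatrix S {i..<N} {0..i}) \<le> 1" if "i < N" for i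
  proof (rule rank_product_entries)
    fix r c assume "r < dim_row (submatrix S {i..<N} {0..i})" "c < dim_col (submatrix S {i..<N} {0..i})"
    then show "submatrix S {i..<N} {0..i} $$ (r, c) = u (pick {i..<N} r) * w (pick {0..i} c)"
      using S pick_low[OF that, of c] pick_high[of r i]
      by (simp add: dim_submatrix submatrix_index lower)
  qed
  moreover have "mat_rank (submatrix S {0..i} {i..<N}) \<le> 1" if "i < N" for i
  proof (rule rank_product_entries)
    fix r c assume "r < dim_row (submatrix S {0..i} {i..<N})" "c < dim_col (submatrix S {0..i} {i..<N})"
    then show "submatrix S {0..i} {i..<N} $$ (r, c) = p (pick {0..i} r) * q (pick {i..<N} c)"
      using S pick_low[OF that, of r] pick_high[of c i]
      by (simp add: dim_submatrix submatrix_index upper)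
  qed
  moreover have "tril S = tril (outer_prod (vec N u) (vec N w))"
    using S by (intro eq_matI) (auto simp: tril_def outer_prod_def lower)
  moreover have "triu S = triu (outer_prod (vec N p) (vec N q))"
    using S by (intro eq_matI) (auto simp: triu_def outer_prod_def upper)
  ultimately show ?thesis
    unfolding generator_representable_semiseparable_def semiseparable_def
    using S vec_carrier[of N] by blast
qed

text \<open>For a zero starting vector the first two spaces are both the zero space, so the least
  index is attained at 1.\<close>

lemma invariance_index_zero:
  assumes A: "A \<in> carrier_mat n n" and adm: "admissible_poles A \<xi>"
  shows "invariance_index A (0\<^sub>v n) \<xi> \<le> 1"
proof -
  have K: "krylov A (0\<^sub>v n) j = {0\<^sub>v n}" for j
  proof -
    have S: "{(A ^\<^sub>m i) *\<^sub>v 0\<^sub>v n | i. i < j} \<subseteq> {0\<^sub>v n}"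
      using mult_mat_zero_vec[OF pow_carrier_mat[OF A]] by auto
    then have c: "{(A ^\<^sub>m i) *\<^sub>v 0\<^sub>v n | i. i < j} \<subseteq> carrier_vec n" by (auto dest: subsetD)
    have "y = 0\<^sub>v n" if "y \<in> krylov A (0\<^sub>v n) j" for y
      using c that[unfolded krylov_def carrier_matD(1)[OF A]]
      by (induction rule: vec_span_induct) (use S in auto)
    moreover have "0\<^sub>v n \<in> krylov A (0\<^sub>v n) j"
      using vec_span_zero[OF c] A unfolding krylov_def by simp
    ultimately show ?thesis by blast
  qed
  have "rational_krylov A (0\<^sub>v n) \<xi> 1 = rational_krylov A (0\<^sub>v n) \<xi> (1 + 1)"
  proof -
    have M: "pole_factor A (\<xi> 1) \<in> carrier_mat n n"
      using A by (auto simp: pole_factor_def minus_carrier_mat)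
    have "minv (1\<^sub>m n) *\<^sub>v 0\<^sub>v n = 0\<^sub>v n"
      by (intro mult_mat_zero_vec minv_mult(1)) auto
    moreover have "minv (pole_factor A (\<xi> 1)) *\<^sub>v 0\<^sub>v n = 0\<^sub>v n"
      by (rule mult_mat_zero_vec[OF minv_mult(1)[OF M pole_factor_kernel[OF A adm order_refl]]])
    moreover have "q_mat A \<xi> (Suc 0) = pole_factor A (\<xi> 1)" "q_mat A \<xi> 0 = 1\<^sub>m n"
      using A M by auto
    ultimately
    show ?thesis unfolding rational_krylov_def K by (simp del: q_mat.simps One_nat_def)
  qed
  then show ?thesis unfolding invariance_index_def by (intro Least_le) simp
qed

section \<open>Assembly of the semiseparable part and the diagonal\<close>

theorem theorem5p6:
  fixes A :: "real mat" and b :: "real vec" and \<xi> :: "nat \<Rightarrow> ereal" and n k :: nat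
  assumes "A \<in> carrier_mat n n"
    and "transpose_mat A = A"
    and "b \<in> carrier_vec n"
    and "admissible_poles A \<xi>"
    and "\<forall>j\<in>{1..k}. \<xi> j \<noteq> 0 \<and> \<xi> j \<noteq> \<infinity> \<and> \<xi> j \<noteq> -\<infinity>"
    and "arnoldi_no_breakdown A b \<xi> k"
    and "k + 1 < invariance_index A b \<xi>"
  shows "\<exists>S. generator_representable_semiseparable (k + 1) S \<and> transpose_mat S = S \<and>
           transpose_mat (arnoldi_mat A b \<xi> k) * A * arnoldi_mat A b \<xi> k =
             S + mat_diag (k + 1) (\<lambda>i. if i = 0 then 0 else real_of_ereal (\<xi> i))"
proof -
  have "b \<noteq> 0\<^sub>v n" using invariance_index_zero[OF assms(1,4)] assms(7) by auto
  then interpret rational_arnoldi A b \<xi> n k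
    using assms by unfold_locales
  obtain \<omega> where \<omega>: "\<And>i j. j \<le> i \<Longrightarrow> i \<le> k \<Longrightarrow>
    v i \<bullet> (A *\<^sub>v v j) = (v i \<bullet> (A *\<^sub>v b)) * \<omega> j + (if i = j then d j else 0)"
    using generators by blast
  define u where "u i = v i \<bullet> (A *\<^sub>v b)" for i
  \<comment> \<open>The lower generators are swapped above the diagonal, which makes
    \<open>S\<close> symmetric and gives the upper generators \<open>\<omega>\<close> and
    \<open>u\<close>.\<close>
  define S where "S = mat (k + 1) (k + 1) (\<lambda>(i, j). if j \<le> i then u i * \<omega> j else \<omega> i * u j)"
  let ?Q = "arnoldi_mat A b \<xi> k"
  have "generator_representable_semiseparable (k + 1) S"
    by (rule generator_representable_semiseparableI[of _ _ u \<omega> \<omega> u]) (auto simp: S_def)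
  moreover have "transpose_mat S = S"
    by (intro eq_matI) (auto simp: S_def)
  moreover have "transpose_mat ?Q * A * ?Q =
      S + mat_diag (k + 1) (\<lambda>i. if i = 0 then 0 else real_of_ereal (\<xi> i))" (is "?J = ?R")
  proof (rule eq_matI)
    fix i j assume "i < dim_row ?R" "j < dim_col ?R"
    then have ij: "i < k + 1" "j < k + 1" by (auto simp: mat_diag_def)
    \<comment> \<open>\<open>\<omega>\<close> describes only entries with \<open>j \<le> i\<close>;
      symmetry of \<open>A\<close> reflects the others.\<close>
    have "v i \<bullet> (A *\<^sub>v v j) = v j \<bullet> (A *\<^sub>v v i)"
      using ij v_carrier by (intro A_symmetric) auto
    then show "?J $$ (i, j) = ?R $$ (i, j)"
      unfolding projection_index[OF ij] using ij \<omega>[of j i] \<omega>[of i j]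
      by (auto simp: S_def mat_diag_def u_def)
  qed (use arnoldi_mat_carrier in \<open>auto simp: mat_diag_def\<close>)
  ultimately show ?thesis by blast
qed

end
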